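(* Let $X_1,\dots,X_m$ be independent and identically distributed from $F$, an absolutely continuous unimodal distribution on $\mathbb{R}$ with density $f$ and a unique mode $\theta_0$. Split the sample into two disjoint, almost equally sized sub-samples $S_1$ and $S_2$ with $|S_1|=m-n$, $|S_2|=n$, and let $\widehat\theta_1$ be any consistent estimate of the mode computed from $S_1$. For $h>0$ and $\alpha\in(0,1)$ let $$\widehat{\mathrm{CS}}_{n,\alpha}^h=\left\{\theta\in\mathbb{R}\;:\;P_n(m_{\theta;h}-m_{\widehat\theta_1;h})\le\frac1h\sqrt{\frac{3}{2n}}\left[\sqrt{\log(1/\alpha)}+2\right]\right\}\pm h,$$ where $m_{\theta;h}(x)=-\frac{1}{2h}\mathbf{1}\{\theta-h<x\le\theta+h\}$ and $P_n$ denotes the average over the sub-sample $S_2$. Then for all $n\ge1$, for any $h>0$ and for any $\alpha\in(0,1)$, $$\mathbb{P}_F\big(\theta_0\in\widehat{\mathrm{CS}}_{n,\alpha}^h\big)\ge1-\alpha.$$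
   Context: Unimodal with mode $\theta_0$: $F$ is convex on $(-\infty,\theta_0]$ and concave on $[\theta_0,\infty)$. For $g:\mathbb{R}\to\mathbb{R}$, $P_n g=\frac1n\sum_{i:X_i\in S_2}g(X_i)$. For $S\subset\mathbb{R}$ and $h>0$, $S\pm h$ denotes the set $\{x\in\mathbb{R}:x-h\in S\text{ or }x+h\in S\}$.
   Formalization: The set S ± h is read as all points within distance h of S, instead of only the points x with x−h or x+h in S; with the two-point reading the coverage claim fails (e.g. a triangular density on [−1,1] with h=2, n=1000, α=1/2). *)

theory Defs
  imports "HOL-Probability.Probability"
begin

definition unimodal_at :: "real measure \<Rightarrow> real \<Rightarrow> bool" where
  "unimodal_at F t \<longleftrightarrow> convex_on {..t} (cdf F) \<and> concave_on {t..} (cdf F)"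

(* An estimator is one function on data lists, hence defined for every sample size;
   its values on lists of length k must depend measurably on the k observations. *)
definition estimator :: "(real list \<Rightarrow> real) \<Rightarrow> bool" where
  "estimator T \<longleftrightarrow>
     (\<forall>k. (\<lambda>x. T (map x [0..<k])) \<in> borel_measurable (Pi\<^sub>M {..<k} (\<lambda>_. borel)))"

(* Convergence in probability to t along i.i.d. samples of size k from F, as k tends to infinity. *)
definition consistent_at :: "(real list \<Rightarrow> real) \<Rightarrow> real measure \<Rightarrow> real \<Rightarrow> bool" where
  "consistent_at T F t \<longleftrightarrow>
     (\<forall>\<epsilon>>0. (\<lambda>k. measure (Pi\<^sub>M {..<k} (\<lambda>_. F))
                   {x \<in> space (Pi\<^sub>M {..<k} (\<lambda>_. F)). \<bar>T (map x [0..<k]) - t\<bar> > \<epsilon>})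
             \<longlonglongrightarrow> 0)"

(* Sub-samples are sets of indices, so that tied observations are counted with multiplicity. *)
definition empirical_mean :: "nat set \<Rightarrow> (nat \<Rightarrow> real) \<Rightarrow> (real \<Rightarrow> real) \<Rightarrow> real" where
  "empirical_mean S x g = 1 / real (card S) * (\<Sum>i\<in>S. g (x i))"

definition window_loss :: "real \<Rightarrow> real \<Rightarrow> real \<Rightarrow> real" where
  "window_loss \<theta> h x = - (1 / (2 * h)) * indicator {\<theta> - h <.. \<theta> + h} x"

(* The enlargement "S plus-minus h", read as the set of points within distance h of S.
   Taking only the end value t = h, i.e. {x. x - h : S or x + h : S}, would make the coverage
   claim false: for a symmetric distribution concentrated on an interval much shorter than h
   around its mode, the windows centred at mode + h and mode - h each capture only half of the
   mass, whereas a window centred near the mode captures all of it. *)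
definition enlarge :: "real set \<Rightarrow> real \<Rightarrow> real set" where
  "enlarge S h = {x. \<exists>t\<in>{0..h}. x - t \<in> S \<or> x + t \<in> S}"

definition mode_confidence_set ::
  "nat set \<Rightarrow> (nat \<Rightarrow> real) \<Rightarrow> real \<Rightarrow> real \<Rightarrow> real \<Rightarrow> real set" where
  "mode_confidence_set S x \<theta>\<^sub>1 h \<alpha> =
     enlarge
       {\<theta>. empirical_mean S x (\<lambda>y. window_loss \<theta> h y - window_loss \<theta>\<^sub>1 h y)
            \<le> 1 / h * sqrt (3 / (2 * real (card S))) * (sqrt (ln (1 / \<alpha>)) + 2)}
       h"

end

theory Submission
  imports Defs
begin

text \<open>
  The population criterion \<open>\<theta> \<mapsto> E m\<^bsub>\<theta>;h\<^esub>\<close> has a minimizer \<open>\<theta>'\<close> within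
  distance \<open>h\<close> of the mode, because the mass of a window of half-width \<open>h\<close> is monotone in its
  centre on either side of \<open>[\<theta>\<^sub>0 - h, \<theta>\<^sub>0 + h]\<close>. So \<open>\<theta>\<^sub>0\<close> is covered as soon
  as \<open>\<theta>'\<close> passes the test, and given the first sub-sample the tested average has non-positive
  mean and bounded summands: Hoeffding's inequality applies.
\<close>

lemma convex_on_increment_mono:
  fixes \<phi> :: "real \<Rightarrow> real"
  assumes "convex_on A \<phi>" "a \<in> A" "b + d \<in> A" "a \<le> b" "0 \<le> d"
  shows "\<phi> (a + d) - \<phi> a \<le> \<phi> (b + d) - \<phi> b"
proof (cases "b + d = a")
  case True
  with assms have "a = b" "d = 0" by auto
  then show ?thesis by simp
next
  case False
  define L where "L = b + d - a"
  have L: "L > 0" using False assms by (simp add: L_def)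
  define t where "t = d / L"
  have t: "0 \<le> t" "t \<le> 1" using L assms by (auto simp: t_def L_def)
  have tL: "t * L = d" using L by (simp add: t_def)
  have "\<phi> ((1 - t) *\<^sub>R a + t *\<^sub>R (b + d)) \<le> (1 - t) * \<phi> a + t * \<phi> (b + d)"
    using convex_onD[OF assms(1) t assms(2,3)] .
  moreover have "\<phi> ((1 - (1 - t)) *\<^sub>R a + (1 - t) *\<^sub>R (b + d)) \<le> (1 - (1 - t)) * \<phi> a + (1 - t) * \<phi> (b + d)"
    using t by (intro convex_onD[OF assms(1) _ _ assms(2,3)]) auto
  moreover have "(1 - t) *\<^sub>R a + t *\<^sub>R (b + d) = a + d"
    using tL by (simp add: L_def algebra_simps)
  moreover have "(1 - (1 - t)) *\<^sub>R a + (1 - t) *\<^sub>R (b + d) = b"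
    using tL by (simp add: L_def algebra_simps)
  ultimately have "\<phi> (a + d) + \<phi> b \<le> \<phi> a + \<phi> (b + d)" by (simp add: algebra_simps)
  then show ?thesis by simp
qed

lemma window_maximizer_near_mode:
  assumes "unimodal_at F \<theta>\<^sub>0" "continuous_on UNIV (cdf F)" "0 \<le> h"
  obtains \<theta>' where "\<theta>' \<in> {\<theta>\<^sub>0 - h..\<theta>\<^sub>0 + h}"
    "\<And>\<theta>. cdf F (\<theta> + h) - cdf F (\<theta> - h) \<le> cdf F (\<theta>' + h) - cdf F (\<theta>' - h)"
proof -
  let ?G = "\<lambda>\<theta>. cdf F (\<theta> + h) - cdf F (\<theta> - h)"
  let ?I = "{\<theta>\<^sub>0 - h..\<theta>\<^sub>0 + h}"
  have convex: "convex_on {..\<theta>\<^sub>0} (cdf F)" "convex_on {\<theta>\<^sub>0..} (\<lambda>x. - cdf F x)"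
    using assms(1) by (auto simp: unimodal_at_def concave_on_def)
  have "continuous_on ?I ?G"
    by (intro continuous_intros continuous_on_compose2[OF assms(2)]) auto
  then obtain \<theta>' where \<theta>': "\<theta>' \<in> ?I" "\<And>\<theta>. \<theta> \<in> ?I \<Longrightarrow> ?G \<theta> \<le> ?G \<theta>'"
    using continuous_attains_sup[of ?I ?G] assms(3) by auto
  have "?G \<theta> \<le> ?G \<theta>'" for \<theta>
  proof -
    consider "\<theta> \<in> ?I" | "\<theta> \<le> \<theta>\<^sub>0 - h" | "\<theta> \<ge> \<theta>\<^sub>0 + h" by fastforce
    then show ?thesis
    proof cases
      case 1
      then show ?thesis by (rule \<theta>')
    next
      case 2
      have "?G \<theta> \<le> ?G (\<theta>\<^sub>0 - h)"
        using convex_on_increment_mono[OF convex(1), of "\<theta> - h" "\<theta>\<^sub>0 - h - h" "2 * h"] 2 assms(3)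
        by (simp add: algebra_simps)
      also have "\<dots> \<le> ?G \<theta>'" using assms(3) by (intro \<theta>') auto
      finally show ?thesis .
    next
      case 3
      have "?G \<theta> \<le> ?G (\<theta>\<^sub>0 + h)"
        using convex_on_increment_mono[OF convex(2), of "\<theta>\<^sub>0" "\<theta> - h" "2 * h"] 3 assms(3)
        by (simp add: algebra_simps)
      also have "\<dots> \<le> ?G \<theta>'" using assms(3) by (intro \<theta>') auto
      finally show ?thesis .
    qed
  qed
  with \<theta>'(1) show ?thesis by (rule that)
qed

lemma (in real_distribution) continuous_on_cdf_density:
  assumes "f \<in> borel_measurable borel" "M = density lborel f"
  shows "continuous_on UNIV (cdf M)"
proof -
  have "{x} \<in> null_sets M" for x
    using absolutely_continuousI_density[of f lborel] assms finite_imp_null_set_lborel[of "{x}"]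
    by (auto simp: absolutely_continuous_def)
  then have "measure M {x} = 0" for x
    by (simp add: measure_eq_0_null_sets)
  then show ?thesis
    by (simp add: continuous_on_eq_continuous_at isCont_cdf)
qed

lemma borel_measurable_window_loss [measurable]:
  assumes [measurable]: "f \<in> borel_measurable N" "g \<in> borel_measurable N"
  shows "(\<lambda>x. window_loss (f x) h (g x)) \<in> borel_measurable N"
  unfolding window_loss_def indicator_def greaterThanAtMost_iff by measurable

lemma window_loss_range:
  assumes "0 < h"
  shows "window_loss \<theta> h x \<in> {- (1 / (2 * h))..0}"
  using assms by (auto simp: window_loss_def indicator_def)

lemma (in real_distribution) integral_window_loss:
  assumes "0 < h"
  shows "integrable M (window_loss \<theta> h)"
    and "integral\<^sup>L M (window_loss \<theta> h) = - (cdf M (\<theta> + h) - cdf M (\<theta> - h)) / (2 * h)"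
proof -
  have [measurable]: "{\<theta> - h<..\<theta> + h} \<in> sets M" by simp
  have eq: "window_loss \<theta> h = (\<lambda>x. - (1 / (2 * h)) * indicator {\<theta> - h<..\<theta> + h} x)"
    by (auto simp: window_loss_def)
  show "integrable M (window_loss \<theta> h)"
    unfolding eq by (intro integrable_mult_right integrable_real_indicator) (auto simp: emeasure_eq_measure)
  show "integral\<^sup>L M (window_loss \<theta> h) = - (cdf M (\<theta> + h) - cdf M (\<theta> - h)) / (2 * h)"
    unfolding eq using assms by (subst cdf_diff_eq) auto
qed

lemma (in prob_space) empirical_mean_Hoeffding:
  fixes g :: "real \<Rightarrow> real"
  assumes indep: "indep_vars (\<lambda>_. borel) X S" and S: "finite S" "S \<noteq> {}"
    and distr: "\<And>i. i \<in> S \<Longrightarrow> distr M borel (X i) = F"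
    and g [measurable]: "g \<in> borel_measurable borel" and range: "\<And>x. g x \<in> {a..b}"
    and "a < b" and "0 \<le> \<epsilon>"
  shows "prob {\<omega> \<in> space M. empirical_mean S (\<lambda>i. X i \<omega>) g \<ge> integral\<^sup>L F g + \<epsilon>}
           \<le> exp (- 2 * real (card S) * \<epsilon>\<^sup>2 / (b - a)\<^sup>2)"
proof -
  obtain j where j: "j \<in> S" using S by blast
  have X [measurable]: "random_variable borel (X i)" if "i \<in> S" for i
    using indep that by (auto simp: indep_vars_def)
  note [measurable] = X[OF j]
  have gX: "distr M borel (\<lambda>\<omega>. g (X i \<omega>)) = distr F borel g" if "i \<in> S" for i
    using X[OF that] by (subst distr[OF that, symmetric], subst distr_distr) (auto simp: comp_def)
  have mean: "expectation (\<lambda>\<omega>. g (X j \<omega>)) = integral\<^sup>L F g"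
    by (subst distr[OF j, symmetric], subst integral_distr) auto
  interpret Hoeffding_ineq_iid M S "\<lambda>i \<omega>. g (X i \<omega>)" "\<lambda>\<omega>. g (X j \<omega>)" a b "integral\<^sup>L F g"
  proof (unfold_locales)
    show "indep_vars (\<lambda>_. borel) (\<lambda>i \<omega>. g (X i \<omega>)) S"
      by (rule indep_vars_compose2[OF indep]) auto
    show "AE \<omega> in M. g (X j \<omega>) \<in> {a..b}" using range by auto
  qed (use S j in \<open>auto simp: gX mean\<close>)
  show ?thesis
    using Hoeffding_ineq_ge'[OF \<open>0 \<le> \<epsilon>\<close> \<open>a < b\<close> S(2)]
    by (simp add: empirical_mean_def)
qed

lemma (in prob_space) prob_indep_var_le:
  assumes indep: "indep_var N1 U N2 V" and B: "B \<in> sets (N1 \<Otimes>\<^sub>M N2)"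
    and slice: "\<And>u. u \<in> space N1 \<Longrightarrow> prob {\<omega> \<in> space M. (u, V \<omega>) \<in> B} \<le> p"
    and "0 \<le> p"
  shows "prob {\<omega> \<in> space M. (U \<omega>, V \<omega>) \<in> B} \<le> p"
proof -
  have [measurable]: "U \<in> measurable M N1" "V \<in> measurable M N2"
    using indep by (auto simp: indep_var_distribution_eq)
  interpret U: prob_space "distr M N1 U" by (rule prob_space_distr) simp
  interpret V: prob_space "distr M N2 V" by (rule prob_space_distr) simp
  have joint: "distr M N1 U \<Otimes>\<^sub>M distr M N2 V = distr M (N1 \<Otimes>\<^sub>M N2) (\<lambda>\<omega>. (U \<omega>, V \<omega>))"
    using indep by (auto simp: indep_var_distribution_eq)
  have "emeasure M {\<omega> \<in> space M. (U \<omega>, V \<omega>) \<in> B}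
      = emeasure (distr M N1 U \<Otimes>\<^sub>M distr M N2 V) B"
    unfolding joint using B by (subst emeasure_distr) (auto intro!: arg_cong[where f = "emeasure M"])
  also have "\<dots> = (\<integral>\<^sup>+u. emeasure (distr M N2 V) (Pair u -` B) \<partial>distr M N1 U)"
    using B by (intro V.emeasure_pair_measure_alt) (simp cong: sets_pair_measure_cong)
  also have "\<dots> \<le> (\<integral>\<^sup>+u. ennreal p \<partial>distr M N1 U)"
  proof (rule nn_integral_mono)
    fix u assume "u \<in> space (distr M N1 U)"
    then have u: "u \<in> space N1" by simp
    have "emeasure (distr M N2 V) (Pair u -` B) = emeasure M {\<omega> \<in> space M. (u, V \<omega>) \<in> B}"
      using sets_Pair1[OF B]
      by (subst emeasure_distr) (auto intro!: arg_cong[where f = "emeasure M"])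
    also have "\<dots> \<le> ennreal p"
      using slice[OF u] by (simp add: emeasure_eq_measure ennreal_leI)
    finally show "emeasure (distr M N2 V) (Pair u -` B) \<le> ennreal p" .
  qed
  also have "\<dots> = ennreal p" using U.emeasure_space_1 by simp
  finally show ?thesis using \<open>0 \<le> p\<close> by (simp add: emeasure_eq_measure)
qed

lemma estimator_measurable_set:
  fixes S :: "nat set"
  assumes "estimator T" "finite S"
  shows "(\<lambda>x. T (map x (sorted_list_of_set S))) \<in> borel_measurable (Pi\<^sub>M S (\<lambda>_. borel))"
proof -
  define l where "l = sorted_list_of_set S"
  have nth: "l ! j \<in> S" if "j < length l" for j
    using nth_mem[OF that] assms(2) by (simp add: l_def)
  have "(\<lambda>x. \<lambda>j\<in>{..<length l}. x (l ! j))
      \<in> measurable (Pi\<^sub>M S (\<lambda>_. borel)) (Pi\<^sub>M {..<length l} (\<lambda>_. borel :: real measure))"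
    using nth by (intro measurable_restrict measurable_component_singleton) auto
  from measurable_compose[OF this, of "\<lambda>y. T (map y [0..<length l])"] assms(1)
  have "(\<lambda>x. T (map (\<lambda>j\<in>{..<length l}. x (l ! j)) [0..<length l])) \<in> borel_measurable (Pi\<^sub>M S (\<lambda>_. borel))"
    by (simp add: estimator_def)
  moreover have "map (\<lambda>j\<in>{..<length l}. x (l ! j)) [0..<length l] = map x l" for x :: "nat \<Rightarrow> real"
    by (intro nth_equalityI) auto
  ultimately show ?thesis by (simp add: l_def)
qed

lemma enlarge_iff:
  assumes "0 \<le> h"
  shows "x \<in> enlarge S h \<longleftrightarrow> (\<exists>\<theta>\<in>{x - h..x + h}. \<theta> \<in> S)"
proof
  assume "\<exists>\<theta>\<in>{x - h..x + h}. \<theta> \<in> S"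
  then obtain \<theta> where \<theta>: "\<theta> \<in> {x - h..x + h}" "\<theta> \<in> S" by blast
  then have "\<bar>x - \<theta>\<bar> \<in> {0..h}" "x - \<bar>x - \<theta>\<bar> = \<theta> \<or> x + \<bar>x - \<theta>\<bar> = \<theta>" by auto
  with \<theta>(2) show "x \<in> enlarge S h" unfolding enlarge_def by (metis (mono_tags, lifting) mem_Collect_eq)
qed (force simp: enlarge_def)

lemma window_loss_right_constant:
  "eventually (\<lambda>\<theta>'. window_loss \<theta>' h y = window_loss \<theta> h y) (at_right \<theta>)"
proof -
  consider "y \<le> \<theta> - h" | "\<theta> - h < y" "y \<le> \<theta> + h" | "\<theta> + h < y" by linarith
  then show ?thesis
  proof cases
    case 1
    then show ?thesis unfolding eventually_at_right_field
      by (intro exI[of _ "\<theta> + 1"]) (auto simp: window_loss_def)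
  next
    case 2
    then show ?thesis unfolding eventually_at_right_field
      by (intro exI[of _ "y + h"]) (auto simp: window_loss_def)
  next
    case 3
    then show ?thesis unfolding eventually_at_right_field
      by (intro exI[of _ "y - h"]) (auto simp: window_loss_def)
  qed
qed

text \<open>
  Coverage is an uncountable union of events over \<open>\<theta>\<close>. Since the empirical criterion is
  right-locally constant in \<open>\<theta>\<close>, rational \<open>\<theta>\<close> and the right end point suffice.
\<close>

lemma mode_confidence_set_countable:
  assumes "finite S" "0 \<le> h"
  shows "x\<^sub>0 \<in> mode_confidence_set S x t h \<alpha> \<longleftrightarrow>
    (\<exists>\<theta>\<in>{x\<^sub>0 - h..x\<^sub>0 + h} \<inter> insert (x\<^sub>0 + h) \<rat>.
       empirical_mean S x (\<lambda>y. window_loss \<theta> h y - window_loss t h y)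
         \<le> 1 / h * sqrt (3 / (2 * real (card S))) * (sqrt (ln (1 / \<alpha>)) + 2))"
    (is "_ \<longleftrightarrow> (\<exists>\<theta>\<in>?I \<inter> ?D. ?E \<theta> \<le> ?c)")
proof -
  have "\<exists>\<theta>\<in>?I \<inter> ?D. ?E \<theta> \<le> ?c" if \<theta>: "\<theta> \<in> ?I" "?E \<theta> \<le> ?c" for \<theta>
  proof (cases "\<theta> = x\<^sub>0 + h")
    case True
    with \<theta> show ?thesis by auto
  next
    case False
    with \<theta> have less: "\<theta> < x\<^sub>0 + h" by auto
    have "eventually (\<lambda>\<theta>'. \<forall>i\<in>S. window_loss \<theta>' h (x i) = window_loss \<theta> h (x i)) (at_right \<theta>)"
      using assms(1) by (intro eventually_ball_finite ballI window_loss_right_constant)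
    then have "eventually (\<lambda>\<theta>'. ?E \<theta>' = ?E \<theta>) (at_right \<theta>)"
      by eventually_elim (simp add: empirical_mean_def)
    then obtain b where b: "b > \<theta>" "\<And>\<theta>'. \<theta> < \<theta>' \<Longrightarrow> \<theta>' < b \<Longrightarrow> ?E \<theta>' = ?E \<theta>"
      unfolding eventually_at_right_field by blast
    obtain q where q: "q \<in> \<rat>" "\<theta> < q" "q < min b (x\<^sub>0 + h)"
      using Rats_dense_in_real[of \<theta> "min b (x\<^sub>0 + h)"] b(1) less by auto
    then have "?E q \<le> ?c" using b(2)[of q] \<theta>(2) by simp
    with q \<theta>(1) show ?thesis by (intro bexI[of _ q]) auto
  qed
  then show ?thesis
    unfolding mode_confidence_set_def enlarge_iff[OF assms(2)] by auto
qed

lemma borel_measurable_empirical_mean: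
  assumes "\<And>i. i \<in> S \<Longrightarrow> (\<lambda>\<omega>. g \<omega> (x \<omega> i)) \<in> borel_measurable N"
  shows "(\<lambda>\<omega>. empirical_mean S (x \<omega>) (g \<omega>)) \<in> borel_measurable N"
  unfolding empirical_mean_def using assms by (intro borel_measurable_times borel_measurable_sum) auto

lemma (in prob_space) mode_confidence_set_event:
  assumes S: "finite S" and h: "0 \<le> h" and X: "\<And>i. i \<in> S \<Longrightarrow> random_variable borel (X i)"
    and t [measurable]: "random_variable borel t"
  shows "{\<omega> \<in> space M. x\<^sub>0 \<in> mode_confidence_set S (\<lambda>i. X i \<omega>) (t \<omega>) h \<alpha>} \<in> events"
proof -
  have event: "{\<omega> \<in> space M. empirical_mean S (\<lambda>i. X i \<omega>)
      (\<lambda>y. window_loss \<theta> h y - window_loss (t \<omega>) h y) \<le> c} \<in> events" for \<theta> c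
    using X by (intro borel_measurable_le borel_measurable_empirical_mean) simp_all
  have "countable ({x\<^sub>0 - h..x\<^sub>0 + h} \<inter> insert (x\<^sub>0 + h) \<rat>)"
    by (simp add: countable_rat)
  then show ?thesis
    unfolding mode_confidence_set_countable[OF S h]
    by (rule sets.sets_Collect_countable_Ex'[OF event])
qed

lemma exp_threshold_le:
  fixes \<alpha> :: real
  assumes "n \<ge> 1" "0 < h" "0 < \<alpha>" "\<alpha> < 1"
  shows "exp (- 2 * real n * (1 / h * sqrt (3 / (2 * real n)) * (sqrt (ln (1 / \<alpha>)) + 2))\<^sup>2
      / (1 / (2 * h) - - (1 / (2 * h)))\<^sup>2) \<le> \<alpha>"
proof -
  define s where "s = sqrt (ln (1 / \<alpha>))"
  have s: "s \<ge> 0" "s\<^sup>2 = - ln \<alpha>" using assms by (auto simp: s_def ln_div)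
  have "(1 / h * sqrt (3 / (2 * real n)) * (s + 2))\<^sup>2 = (1 / h)\<^sup>2 * (3 / (2 * real n)) * (s + 2)\<^sup>2"
    using assms by (simp add: power_mult_distrib power_divide)
  moreover have "1 / (2 * h) - - (1 / (2 * h)) = 1 / h" by simp
  ultimately have "- 2 * real n * (1 / h * sqrt (3 / (2 * real n)) * (s + 2))\<^sup>2
      / (1 / (2 * h) - - (1 / (2 * h)))\<^sup>2 = - 3 * (s + 2)\<^sup>2"
    using assms by (simp add: field_simps)
  also have "\<dots> \<le> - s\<^sup>2" using s(1) power_mono[of s "s + 2" 2] zero_le_power2[of "s + 2"] by linarith
  also have "\<dots> = ln \<alpha>" using s by simp
  finally show ?thesis using assms unfolding s_def by (metis exp_le_cancel_iff exp_ln)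
qed

theorem theorem3:
  fixes M :: "'a measure"
    and F :: "real measure"
    and f :: "real \<Rightarrow> real"
    and X :: "nat \<Rightarrow> 'a \<Rightarrow> real"
    and T :: "real list \<Rightarrow> real"
    and S\<^sub>1 S\<^sub>2 :: "nat set"
    and m n :: nat
    and \<theta>\<^sub>0 h \<alpha> :: real
  assumes "prob_space M"
    and "real_distribution F"
    and "f \<in> borel_measurable borel" and "\<And>x. 0 \<le> f x"
    and "F = density lborel (\<lambda>x. ennreal (f x))"
    and "unimodal_at F \<theta>\<^sub>0" and "\<And>t. unimodal_at F t \<Longrightarrow> t = \<theta>\<^sub>0"
    and "prob_space.indep_vars M (\<lambda>_. borel) X {1..m}"
    and "\<And>i. i \<in> {1..m} \<Longrightarrow> distr M borel (X i) = F"
    and "S\<^sub>1 \<union> S\<^sub>2 = {1..m}" and "S\<^sub>1 \<inter> S\<^sub>2 = {}"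
    and "card S\<^sub>1 = m - n" and "card S\<^sub>2 = n"
    and "\<bar>int (card S\<^sub>1) - int (card S\<^sub>2)\<bar> \<le> 1"
    and "estimator T" and "consistent_at T F \<theta>\<^sub>0"
    and "n \<ge> 1" and "h > 0" and "0 < \<alpha>" and "\<alpha> < 1"
  shows "measure M {\<omega> \<in> space M.
           \<theta>\<^sub>0 \<in> mode_confidence_set S\<^sub>2 (\<lambda>i. X i \<omega>)
                  (T (map (\<lambda>i. X i \<omega>) (sorted_list_of_set S\<^sub>1))) h \<alpha>} \<ge> 1 - \<alpha>"
proof -
  interpret prob_space M by fact
  interpret F: real_distribution F by fact
  note indep = \<open>indep_vars (\<lambda>_. borel) X {1..m}\<close>
  note distr = \<open>\<And>i. i \<in> {1..m} \<Longrightarrow> distr M borel (X i) = F\<close>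
  have sub: "S\<^sub>1 \<subseteq> {1..m}" "S\<^sub>2 \<subseteq> {1..m}" using \<open>S\<^sub>1 \<union> S\<^sub>2 = {1..m}\<close> by auto
  have fin: "finite S\<^sub>1" "finite S\<^sub>2" using sub by (auto intro: finite_subset)
  have ne: "S\<^sub>2 \<noteq> {}" using \<open>card S\<^sub>2 = n\<close> \<open>n \<ge> 1\<close> by auto
  have h: "0 \<le> h" using \<open>h > 0\<close> by simp
  have X: "random_variable borel (X i)" if "i \<in> {1..m}" for i
    using indep that by (auto simp: indep_vars_def)

  have "continuous_on UNIV (cdf F)"
    using F.continuous_on_cdf_density[of "\<lambda>x. ennreal (f x)"] assms(3,5) by simp
  then obtain \<theta>' where \<theta>': "\<theta>' \<in> {\<theta>\<^sub>0 - h..\<theta>\<^sub>0 + h}"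
    "\<And>\<theta>. cdf F (\<theta> + h) - cdf F (\<theta> - h) \<le> cdf F (\<theta>' + h) - cdf F (\<theta>' - h)"
    using window_maximizer_near_mode[OF \<open>unimodal_at F \<theta>\<^sub>0\<close> _ h] by blast

  define c where "c = 1 / h * sqrt (3 / (2 * real n)) * (sqrt (ln (1 / \<alpha>)) + 2)"
  have c: "0 \<le> c" using h \<open>0 < \<alpha>\<close> \<open>\<alpha> < 1\<close> by (auto simp: c_def intro!: add_nonneg_nonneg)
  define est where "est x = T (map x (sorted_list_of_set S\<^sub>1))" for x :: "nat \<Rightarrow> real"
  let ?U = "\<lambda>\<omega>. \<lambda>i\<in>S\<^sub>1. X i \<omega>"
  let ?N\<^sub>1 = "Pi\<^sub>M S\<^sub>1 (\<lambda>_. borel :: real measure)"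
  let ?V = "\<lambda>\<omega>. \<lambda>i\<in>S\<^sub>2. X i \<omega>"
  let ?N = "Pi\<^sub>M S\<^sub>2 (\<lambda>_. borel :: real measure)"
  define gap where "gap x t = empirical_mean S\<^sub>2 x (\<lambda>y. window_loss \<theta>' h y - window_loss t h y)" for x t
  define B where "B = {z \<in> space (?N\<^sub>1 \<Otimes>\<^sub>M ?N). c \<le> gap (snd z) (est (fst z))}"
  have gap_restrict: "gap (restrict x S\<^sub>2) t = gap x t" for x t
    by (simp add: gap_def empirical_mean_def)

  have UV: "indep_var ?N\<^sub>1 ?U ?N ?V"
    by (rule indep_var_restrict[OF indep \<open>S\<^sub>1 \<inter> S\<^sub>2 = {}\<close> sub])
  have est [measurable]: "est \<in> borel_measurable ?N\<^sub>1"
    unfolding est_def[abs_def] by (rule estimator_measurable_set[OF \<open>estimator T\<close> fin(1)])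
  have est_restrict: "est (?U \<omega>) = est (\<lambda>i. X i \<omega>)" for \<omega>
    using fin by (auto simp: est_def intro!: arg_cong[where f = T])
  have est_rv: "random_variable borel (\<lambda>\<omega>. est (\<lambda>i. X i \<omega>))"
    using measurable_compose[OF indep_var_rv1[OF UV] est] by (simp add: est_restrict)
  have B: "B \<in> sets (?N\<^sub>1 \<Otimes>\<^sub>M ?N)"
    unfolding B_def gap_def
    by (intro borel_measurable_le borel_measurable_empirical_mean) simp_all
  have "prob {\<omega> \<in> space M. (u, ?V \<omega>) \<in> B} \<le> \<alpha>" if "u \<in> space ?N\<^sub>1" for u
  proof -
    define t where "t = est u"
    let ?g = "\<lambda>y. window_loss \<theta>' h y - window_loss t h y"
    have "integral\<^sup>L F ?g \<le> 0"
      using \<theta>'(2)[of t] \<open>h > 0\<close> F.integral_window_loss[OF \<open>h > 0\<close>, of t] F.integral_window_loss[OF \<open>h > 0\<close>, of \<theta>']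
      by (simp add: divide_right_mono)
    moreover have "{\<omega> \<in> space M. integral\<^sup>L F ?g + c \<le> gap (\<lambda>i. X i \<omega>) t} \<in> events"
      unfolding gap_def using X sub
      by (intro borel_measurable_le borel_measurable_empirical_mean) (auto simp: subset_iff)
    ultimately have "prob {\<omega> \<in> space M. (u, ?V \<omega>) \<in> B}
        \<le> prob {\<omega> \<in> space M. integral\<^sup>L F ?g + c \<le> gap (\<lambda>i. X i \<omega>) t}"
      by (intro finite_measure_mono) (auto simp: B_def gap_restrict t_def)
    also have "\<dots> \<le> exp (- 2 * real (card S\<^sub>2) * c\<^sup>2 / (1 / (2 * h) - - (1 / (2 * h)))\<^sup>2)"
      unfolding gap_def
    proof (rule empirical_mean_Hoeffding)
      show "indep_vars (\<lambda>_. borel) X S\<^sub>2" using indep_vars_subset[OF indep sub(2)] .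
      show "?g y \<in> {- (1 / (2 * h))..1 / (2 * h)}" for y
        using window_loss_range[OF \<open>h > 0\<close>, of \<theta>' y] window_loss_range[OF \<open>h > 0\<close>, of t y] by simp
          show "(\<lambda>y. window_loss \<theta>' h y - window_loss t h y) \<in> borel_measurable borel" by simp
      show "distr M borel (X i) = F" if "i \<in> S\<^sub>2" for i using distr sub(2) that by blast
      show "- (1 / (2 * h)) < 1 / (2 * h)" using \<open>h > 0\<close> by (simp add: field_simps)
    qed (fact fin ne c)+
    also have "\<dots> \<le> \<alpha>"
      unfolding c_def \<open>card S\<^sub>2 = n\<close> by (rule exp_threshold_le) fact+
    finally show ?thesis .
  qed
  then have bad: "prob {\<omega> \<in> space M. (?U \<omega>, ?V \<omega>) \<in> B} \<le> \<alpha>"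
    using \<open>0 < \<alpha>\<close> by (intro prob_indep_var_le[OF UV B]) auto
  have bad_event: "{\<omega> \<in> space M. (?U \<omega>, ?V \<omega>) \<in> B} \<in> events"
    using measurable_sets[OF measurable_Pair[OF indep_var_rv1[OF UV] indep_var_rv2[OF UV]] B]
    by (simp add: vimage_def Int_def conj_commute)
  let ?cover = "{\<omega> \<in> space M. \<theta>\<^sub>0 \<in> mode_confidence_set S\<^sub>2 (\<lambda>i. X i \<omega>) (est (\<lambda>i. X i \<omega>)) h \<alpha>}"
  have "space M - {\<omega> \<in> space M. (?U \<omega>, ?V \<omega>) \<in> B} \<subseteq> ?cover"
  proof
    fix \<omega> assume \<omega>: "\<omega> \<in> space M - {\<omega> \<in> space M. (?U \<omega>, ?V \<omega>) \<in> B}"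
    then have "gap (\<lambda>i. X i \<omega>) (est (\<lambda>i. X i \<omega>)) \<le> c"
      by (auto simp: B_def space_pair_measure space_PiM gap_restrict est_restrict)
    with \<theta>'(1) have "\<theta>\<^sub>0 \<in> mode_confidence_set S\<^sub>2 (\<lambda>i. X i \<omega>) (est (\<lambda>i. X i \<omega>)) h \<alpha>"
      unfolding mode_confidence_set_def enlarge_iff[OF h] gap_def c_def \<open>card S\<^sub>2 = n\<close> by blast
    with \<omega> show "\<omega> \<in> ?cover" by simp
  qed
  moreover have "?cover \<in> events"
    using X sub(2) by (intro mode_confidence_set_event fin h est_rv) blast
  ultimately have "prob (space M - {\<omega> \<in> space M. (?U \<omega>, ?V \<omega>) \<in> B}) \<le> prob ?cover"
    by (rule finite_measure_mono)
  then show ?thesis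
    using bad prob_compl[OF bad_event] by (simp add: est_def)
qed

end
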